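(* Let $\mathbf{K}=\bigcup_n\mathbf{A}_n$ be a Fraïssé structure with fixed exhaustion such that every $\mathbf{A}_n$ has finite big Ramsey degree $R_n$, let $G=\mathrm{Aut}(\mathbf{K})$, and let $\mathcal{K}=\{\mathbf{A}:\mathbf{A}\cong\mathbf{A}_n\text{ for some }n\}$. Assume $G$ is Roelcke precompact, and let $\mathcal{K}'$ be the big Ramsey expansion of $\mathcal{K}$. Then $\mathcal{K}'$ has the Joint Embedding Property: for any $\mathbf{A}',\mathbf{B}'\in\mathcal{K}'$ there is $\mathbf{C}'\in\mathcal{K}'$ into which both $\mathbf{A}'$ and $\mathbf{B}'$ embed.
   Context: $G=\mathrm{Aut}(\mathbf{K})$ carries the pointwise convergence topology; it is Roelcke precompact if for every open $U\ni 1_G$ there is a finite $F\subseteq G$ with $UFU=G$. Fraïssé: countable, every embedding of a finite substructure into $\mathbf{K}$ extends to an automorphism. Exhaustion: finite substructures $\emptyset=\mathbf{A}_0\subseteq\mathbf{A}_1\subseteq\cdots$ with union $\mathbf{K}$; $H_m=\mathrm{Emb}(\mathbf{A}_m,\mathbf{K})$, $H_m^n=\mathrm{Emb}(\mathbf{A}_m,\mathbf{A}_n)$, $\widehat G=\mathrm{Emb}(\mathbf{K},\mathbf{K})$. $\mathbf{B}\cdot f$ denotes the structure on the domain of an injection $f$ making $f$ an embedding into $\mathbf{B}$. Big Ramsey degree of $\mathbf{A}_n$: least $\ell$ such that for every $r>\ell$ and every $\gamma:H_n\to r$ there is $\eta\in\widehat G$ with $|\{\gamma(\eta\circ f):f\in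 H_n\}|\le\ell$. A set $S\subseteq H_m$ is unavoidable if $\{f\in H_m:\eta\circ f\in S\}\neq\emptyset$ for all $\eta\in\widehat G$; an unavoidable $k$-coloring of $H_m$ is a map from $H_m$ to a finite set with image of size $k$ and all nonempty fibers unavoidable. For colorings $\gamma$ of $H_m$, $\delta$ of $H_n$ ($m\le n$), $\gamma\ll\delta$ means $\delta(s_0)=\delta(s_1)\Rightarrow\gamma(s_0\circ f)=\gamma(s_1\circ f)$ for all $f\in H_m^n$, $s_0,s_1\in H_n$. An expansion of $\mathcal{K}$ is a class $\mathcal{K}^*$ of $L^*$-structures ($L^*\supseteq L$) with $\mathbf{A}^*|_L\in\mathcal{K}$ for all $\mathbf{A}^*\in\mathcal{K}^*$, every $\mathbf{A}\in\mathcal{K}$ having at least one expansion in $\mathcal{K}^*$ (set $\mathcal{K}^*(\mathbf{A})$), and $\mathbf{B}^*\cdot f\in\mathcal{K}^*(\mathbf{A})$ whenever $\mathbf{A}\in\mathcal{K}$, $\mathbf{B}^*\in\mathcal{K}^*$, $f:\mathbf{A}\to\mathbf{B}^*|_L$ an embedding. Precompact: each $\mathcal{K}^*(\mathbf{A})$ finite. Reasonable: for each embedding $f:\mathbf{A}\to\mathbf{B}$ in $\mathcal{K}$, $\mathbf{B}^*\mapsto\mathbf{B}^*\cdot f$ maps $\mathcal{K}^*(\mathbf{B})$ onto $\mathcal{K}^*(\mathbf{A})$. The big Ramsey expansion of $\mathcal{K}$ is a reasonable precompact expansion $\mathcal{K}'$ such that for every $r<\omega$ there are unavoidable $R_n$-colorings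 $\gamma_n$ of $H_n$ ($n<r$) with $\gamma_m\ll\gamma_n$ for $m\le n<r$ and bijections $\sigma_n:\mathrm{im}(\gamma_n)\to\mathcal{K}'(\mathbf{A}_n)$ with $\sigma_m(\gamma_m(s\circ f))=\sigma_n(\gamma_n(s))\cdot f$ for all $m\le n<r$, $s\in H_n$, $f\in H_m^n$ (it exists and is unique up to isomorphism of expansions). *)

theory Defs
  imports "HOL-Analysis.Function_Topology" "HOL-Algebra.Bij" "HOL-Algebra.Coset"
begin

section \<open>Relational structures\<close>

text \<open>
  Relation symbols come from a type \<open>'r\<close> with a fixed arity function; a language is a set of symbols.
  The symbols outside the language of a structure are interpreted by the empty relation
  (see \<open>lang_structure\<close>). So equality of \<open>rel_struct\<close>s is equality of structures, and
  embeddings may quantify over all symbols.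
\<close>

record ('a, 'r) rel_struct =
  universe :: "'a set"
  rel :: "'r \<Rightarrow> 'a list set"

definition lang_structure :: "('r \<Rightarrow> nat) \<Rightarrow> 'r set \<Rightarrow> ('a, 'r) rel_struct \<Rightarrow> bool" where
  "lang_structure ar L A \<longleftrightarrow>
     (\<forall>r\<in>L. rel A r \<subseteq> {xs. set xs \<subseteq> universe A \<and> length xs = ar r}) \<and>
     (\<forall>r. r \<notin> L \<longrightarrow> rel A r = {})"

definition reduct :: "'r set \<Rightarrow> ('a, 'r) rel_struct \<Rightarrow> ('a, 'r) rel_struct" where
  "reduct L A = \<lparr>universe = universe A, rel = (\<lambda>r. if r \<in> L then rel A r else {})\<rparr>"

definition substructure :: "('a, 'r) rel_struct \<Rightarrow> ('a, 'r) rel_struct \<Rightarrow> bool" where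
  "substructure A B \<longleftrightarrow>
     universe A \<subseteq> universe B \<and> (\<forall>r. rel A r = {xs \<in> rel B r. set xs \<subseteq> universe A})"

text \<open>
  Embeddings are extensional functions on the universe of the source, so that they form the right
  set of maps; accordingly they are composed with the library's \<open>compose\<close>.
\<close>

definition Emb :: "('a, 'r) rel_struct \<Rightarrow> ('a, 'r) rel_struct \<Rightarrow> ('a \<Rightarrow> 'a) set" where
  "Emb A B = {f \<in> universe A \<rightarrow>\<^sub>E universe B. inj_on f (universe A) \<and>
     (\<forall>r xs. set xs \<subseteq> universe A \<longrightarrow> (xs \<in> rel A r \<longleftrightarrow> map f xs \<in> rel B r))}"

definition iso_structures :: "('a, 'r) rel_struct \<Rightarrow> ('a, 'r) rel_struct \<Rightarrow> bool" where
  "iso_structures A B \<longleftrightarrow> (\<exists>f\<in>Emb A B. f ` universe A = universe B)"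

text \<open>\<open>pullback X B f\<close> is the structure \<open>B \<cdot> f\<close>, where \<open>X\<close> is the domain of the injection \<open>f\<close>.\<close>

definition pullback ::
    "'a set \<Rightarrow> ('a, 'r) rel_struct \<Rightarrow> ('a \<Rightarrow> 'a) \<Rightarrow> ('a, 'r) rel_struct" where
  "pullback X B f =
     \<lparr>universe = X, rel = (\<lambda>r. {xs. set xs \<subseteq> X \<and> map f xs \<in> rel B r})\<rparr>"


section \<open>The automorphism group and Roelcke precompactness\<close>

definition Aut :: "('a, 'r) rel_struct \<Rightarrow> ('a \<Rightarrow> 'a) set" where
  "Aut K = Emb K K \<inter> Bij (universe K)"

definition Aut_group :: "('a, 'r) rel_struct \<Rightarrow> ('a \<Rightarrow> 'a) monoid" where
  "Aut_group K = (BijGroup (universe K))\<lparr>carrier := Aut K\<rparr>"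

definition pointwise_topology :: "('a, 'r) rel_struct \<Rightarrow> ('a \<Rightarrow> 'a) topology" where
  "pointwise_topology K =
     subtopology (product_topology (\<lambda>_. discrete_topology (universe K)) (universe K)) (Aut K)"

definition Roelcke_precompact :: "('g, 'b) monoid_scheme \<Rightarrow> 'g topology \<Rightarrow> bool" where
  "Roelcke_precompact G T \<longleftrightarrow>
     (\<forall>U. openin T U \<and> \<one>\<^bsub>G\<^esub> \<in> U \<longrightarrow>
        (\<exists>F\<subseteq>carrier G. finite F \<and> U <#>\<^bsub>G\<^esub> F <#>\<^bsub>G\<^esub> U = carrier G))"


section \<open>Fraisse structures and exhaustions\<close>

definition Fraisse_structure :: "('r \<Rightarrow> nat) \<Rightarrow> 'r set \<Rightarrow> ('a, 'r) rel_struct \<Rightarrow> bool" where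
  "Fraisse_structure ar L K \<longleftrightarrow>
     lang_structure ar L K \<and> countable (universe K) \<and>
     (\<forall>A f. substructure A K \<and> finite (universe A) \<and> f \<in> Emb A K \<longrightarrow>
        (\<exists>g\<in>Aut K. \<forall>x\<in>universe A. g x = f x))"

definition exhaustion :: "('a, 'r) rel_struct \<Rightarrow> (nat \<Rightarrow> ('a, 'r) rel_struct) \<Rightarrow> bool" where
  "exhaustion K A \<longleftrightarrow>
     universe (A 0) = {} \<and>
     (\<forall>n. finite (universe (A n)) \<and> substructure (A n) K \<and> substructure (A n) (A (Suc n))) \<and>
     (\<Union>n. universe (A n)) = universe K"

definition age_class ::
    "('r \<Rightarrow> nat) \<Rightarrow> 'r set \<Rightarrow> (nat \<Rightarrow> ('a, 'r) rel_struct) \<Rightarrow> ('a, 'r) rel_struct set" where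
  "age_class ar L A = {B. lang_structure ar L B \<and> (\<exists>n. iso_structures B (A n))}"


section \<open>Big Ramsey degrees and unavoidable colorings\<close>

definition big_Ramsey_bound :: "('a, 'r) rel_struct \<Rightarrow> ('a, 'r) rel_struct \<Rightarrow> nat \<Rightarrow> bool" where
  "big_Ramsey_bound K A l \<longleftrightarrow>
     (\<forall>r>l. \<forall>\<gamma> \<in> Emb A K \<rightarrow> {..<r}. \<exists>\<eta>\<in>Emb K K.
        card {\<gamma> (compose (universe A) \<eta> f) | f. f \<in> Emb A K} \<le> l)"

definition finite_big_Ramsey_degree ::
    "('a, 'r) rel_struct \<Rightarrow> ('a, 'r) rel_struct \<Rightarrow> bool" where
  "finite_big_Ramsey_degree K A \<longleftrightarrow> (\<exists>l. big_Ramsey_bound K A l)"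

text \<open>Meaningful only if \<open>finite_big_Ramsey_degree K A\<close>.\<close>

definition big_Ramsey_degree :: "('a, 'r) rel_struct \<Rightarrow> ('a, 'r) rel_struct \<Rightarrow> nat" where
  "big_Ramsey_degree K A = (LEAST l. big_Ramsey_bound K A l)"

definition unavoidable ::
    "('a, 'r) rel_struct \<Rightarrow> ('a, 'r) rel_struct \<Rightarrow> ('a \<Rightarrow> 'a) set \<Rightarrow> bool" where
  "unavoidable K A S \<longleftrightarrow>
     S \<subseteq> Emb A K \<and> (\<forall>\<eta>\<in>Emb K K. {f \<in> Emb A K. compose (universe A) \<eta> f \<in> S} \<noteq> {})"

definition unavoidable_coloring ::
    "('a, 'r) rel_struct \<Rightarrow> ('a, 'r) rel_struct \<Rightarrow> nat \<Rightarrow> (('a \<Rightarrow> 'a) \<Rightarrow> 'c) \<Rightarrow> bool" where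
  "unavoidable_coloring K A k \<gamma> \<longleftrightarrow>
     finite (\<gamma> ` Emb A K) \<and> card (\<gamma> ` Emb A K) = k \<and>
     (\<forall>c \<in> \<gamma> ` Emb A K. unavoidable K A {f \<in> Emb A K. \<gamma> f = c})"

text \<open>\<open>coloring_refines K A B \<gamma> \<delta>\<close> is \<open>\<gamma> \<lless> \<delta>\<close>, for colorings \<open>\<gamma>\<close> of \<open>Emb A K\<close> and \<open>\<delta>\<close> of \<open>Emb B K\<close>.\<close>

definition coloring_refines ::
    "('a, 'r) rel_struct \<Rightarrow> ('a, 'r) rel_struct \<Rightarrow> ('a, 'r) rel_struct \<Rightarrow>
      (('a \<Rightarrow> 'a) \<Rightarrow> 'c) \<Rightarrow> (('a \<Rightarrow> 'a) \<Rightarrow> 'd) \<Rightarrow> bool" where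
  "coloring_refines K A B \<gamma> \<delta> \<longleftrightarrow>
     (\<forall>f\<in>Emb A B. \<forall>s0\<in>Emb B K. \<forall>s1\<in>Emb B K. \<delta> s0 = \<delta> s1 \<longrightarrow>
        \<gamma> (compose (universe A) s0 f) = \<gamma> (compose (universe A) s1 f))"


section \<open>Expansions\<close>

definition expansions_of ::
    "'r set \<Rightarrow> ('a, 'r) rel_struct set \<Rightarrow> ('a, 'r) rel_struct \<Rightarrow> ('a, 'r) rel_struct set" where
  "expansions_of L KS A = {B \<in> KS. reduct L B = A}"

definition expansion_class ::
    "('r \<Rightarrow> nat) \<Rightarrow> 'r set \<Rightarrow> 'r set \<Rightarrow>
      ('a, 'r) rel_struct set \<Rightarrow> ('a, 'r) rel_struct set \<Rightarrow> bool" where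
  "expansion_class ar L L' KK KS \<longleftrightarrow>
     L \<subseteq> L' \<and>
     (\<forall>B\<in>KS. lang_structure ar L' B \<and> reduct L B \<in> KK) \<and>
     (\<forall>A\<in>KK. expansions_of L KS A \<noteq> {}) \<and>
     (\<forall>A\<in>KK. \<forall>B\<in>KS. \<forall>f\<in>Emb A (reduct L B).
        pullback (universe A) B f \<in> expansions_of L KS A)"

definition precompact_expansion ::
    "'r set \<Rightarrow> ('a, 'r) rel_struct set \<Rightarrow> ('a, 'r) rel_struct set \<Rightarrow> bool" where
  "precompact_expansion L KK KS \<longleftrightarrow> (\<forall>A\<in>KK. finite (expansions_of L KS A))"

definition reasonable_expansion ::
    "'r set \<Rightarrow> ('a, 'r) rel_struct set \<Rightarrow> ('a, 'r) rel_struct set \<Rightarrow> bool" where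
  "reasonable_expansion L KK KS \<longleftrightarrow>
     (\<forall>A\<in>KK. \<forall>B\<in>KK. \<forall>f\<in>Emb A B.
        (\<lambda>B'. pullback (universe A) B' f) ` expansions_of L KS B = expansions_of L KS A)"

text \<open>
  The big Ramsey expansion is determined only up to isomorphism of expansions, hence the predicate.
  Colors are natural numbers: the colorings have finite image, so this loses no generality.
  The family \<open>\<gamma>\<close>, \<open>\<sigma>\<close> may depend on \<open>r\<close>, and only its members below \<open>r\<close> matter.
\<close>

definition big_Ramsey_expansion ::
    "('r \<Rightarrow> nat) \<Rightarrow> 'r set \<Rightarrow> 'r set \<Rightarrow> ('a, 'r) rel_struct \<Rightarrow>
      (nat \<Rightarrow> ('a, 'r) rel_struct) \<Rightarrow> ('a, 'r) rel_struct set \<Rightarrow> bool" where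
  "big_Ramsey_expansion ar L L' K A KS \<longleftrightarrow>
     expansion_class ar L L' (age_class ar L A) KS \<and>
     precompact_expansion L (age_class ar L A) KS \<and>
     reasonable_expansion L (age_class ar L A) KS \<and>
     (\<forall>r. \<exists>(\<gamma> :: nat \<Rightarrow> ('a \<Rightarrow> 'a) \<Rightarrow> nat) (\<sigma> :: nat \<Rightarrow> nat \<Rightarrow> ('a, 'r) rel_struct).
        (\<forall>n<r. unavoidable_coloring K (A n) (big_Ramsey_degree K (A n)) (\<gamma> n)) \<and>
        (\<forall>n<r. \<forall>m\<le>n. coloring_refines K (A m) (A n) (\<gamma> m) (\<gamma> n)) \<and>
        (\<forall>n<r. bij_betw (\<sigma> n) (\<gamma> n ` Emb (A n) K) (expansions_of L KS (A n))) \<and>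
        (\<forall>n<r. \<forall>m\<le>n. \<forall>s\<in>Emb (A n) K. \<forall>f\<in>Emb (A m) (A n).
           \<sigma> m (\<gamma> m (compose (universe (A m)) s f)) =
           pullback (universe (A m)) (\<sigma> n (\<gamma> n s)) f))"

definition joint_embedding_property :: "('a, 'r) rel_struct set \<Rightarrow> bool" where
  "joint_embedding_property KS \<longleftrightarrow>
     (\<forall>A\<in>KS. \<forall>B\<in>KS. \<exists>C\<in>KS. Emb A C \<noteq> {} \<and> Emb B C \<noteq> {})"

end

theory Submission
  imports Defs
begin

text \<open>
  Reasonability reduces the claim to two expansions of one \<open>A m\<close>, that is, to two colors of
  \<open>\<gamma> m\<close>. Roelcke precompactness says that \<open>G\<close> has finitely many orbits on pairs of embeddings
  of \<open>A m\<close>, so some \<open>A n\<close> contains a copy of every such pair up to \<open>G\<close>. Since \<open>n\<close> does not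
  depend on the colorings, a system of colorings of length \<open>n + 1\<close> may be chosen afterwards; if
  \<open>f\<close> and \<open>g\<close> have the two given colors and factor through \<open>s \<in> Emb (A n) K\<close>, then the
  expansion of \<open>A n\<close> attached to the color of \<open>s\<close> is a joint extension.
\<close>

section \<open>Embeddings\<close>

lemma compose_Emb:
  assumes f: "f \<in> Emb A B" and g: "g \<in> Emb B C"
  shows "compose (universe A) g f \<in> Emb A C"
proof -
  have fB: "f \<in> universe A \<rightarrow> universe B" and gC: "g \<in> universe B \<rightarrow> universe C"
    using f g by (auto simp: Emb_def)
  have "inj_on (compose (universe A) g f) (universe A)"
    using f g by (auto simp: Emb_def inj_on_def compose_eq PiE_iff)
  moreover have "xs \<in> rel A r \<longleftrightarrow> map (compose (universe A) g f) xs \<in> rel C r"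
    if "set xs \<subseteq> universe A" for r xs
  proof -
    have "map (compose (universe A) g f) xs = map g (map f xs)"
      using that by (auto simp: compose_def)
    moreover have "set (map f xs) \<subseteq> universe B"
      using that fB by auto
    then have "map f xs \<in> rel B r \<longleftrightarrow> map g (map f xs) \<in> rel C r"
      using g unfolding Emb_def by blast
    moreover have "xs \<in> rel A r \<longleftrightarrow> map f xs \<in> rel B r"
      using f that by (simp add: Emb_def)
    ultimately show ?thesis by (simp only:)
  qed
  moreover have "compose (universe A) g f \<in> universe A \<rightarrow>\<^sub>E universe C"
    unfolding PiE_def by (intro IntI funcset_compose[OF fB gC] compose_extensional)
  ultimately show ?thesis
    unfolding Emb_def mem_Collect_eq by (intro conjI allI impI)
qed

text \<open>Relations need to agree only on tuples from \<open>A\<close>. This covers inclusions of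
  substructures and, with both structures equal to \<open>K\<close>, the unit of
  \<open>Aut_group K\<close>.\<close>

lemma inclusion_Emb:
  assumes "universe A \<subseteq> universe B"
    and "\<And>r xs. set xs \<subseteq> universe A \<Longrightarrow> xs \<in> rel A r \<longleftrightarrow> xs \<in> rel B r"
  shows "restrict id (universe A) \<in> Emb A B"
proof -
  have "map (restrict id (universe A)) xs = xs" if "set xs \<subseteq> universe A" for xs
    using that by (intro map_idI) auto
  then show ?thesis
    using assms by (auto simp: Emb_def inj_on_def)
qed

lemma substructure_inclusion:
  "substructure A B \<Longrightarrow> restrict id (universe A) \<in> Emb A B"
  by (rule inclusion_Emb) (auto simp: substructure_def)

lemma substructure_of_common:
  assumes "substructure A C" "substructure B C" "universe A \<subseteq> universe B"
  shows "substructure A B"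
  using assms by (auto simp: substructure_def)

lemma Emb_into_substructure:
  assumes f: "f \<in> Emb A C" and B: "substructure B C" and im: "f ` universe A \<subseteq> universe B"
  shows "f \<in> Emb A B"
proof -
  have "map f xs \<in> rel B r \<longleftrightarrow> map f xs \<in> rel C r" if "set xs \<subseteq> universe A" for r xs
    using that B im unfolding substructure_def by fastforce
  then show ?thesis
    using f im by (auto simp: Emb_def PiE_iff)
qed

lemma Emb_pullback:
  assumes "f \<in> X \<rightarrow>\<^sub>E universe B" "inj_on f X"
  shows "f \<in> Emb (pullback X B f) B"
  using assms by (simp add: Emb_def pullback_def)

lemma universe_expansion: "B \<in> expansions_of L KS A \<Longrightarrow> universe B = universe A"
  by (auto simp: expansions_of_def reduct_def)

text \<open>\<open>f\<close> is only assumed to respect the relations of \<open>B\<close>, the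
  reduct of \<open>C\<close>. Giving its source the preimages of the relations of \<open>C\<close>
  makes it respect all of them.\<close>

lemma Emb_pullback_expansion:
  assumes "f \<in> Emb A B" "C \<in> expansions_of L KS B"
  shows "f \<in> Emb (pullback (universe A) C f) C"
  using assms by (intro Emb_pullback) (auto simp: Emb_def dest: universe_expansion)


section \<open>Automorphisms\<close>

text \<open>\<open>g\<close> carries the tuple \<open>map ?h xs\<close> back to \<open>xs\<close>,
  so preservation by the inverse follows from preservation by \<open>g\<close>. The
  \<open>restrict\<close> makes the inverse extensional, as \<open>Emb\<close> demands.\<close>

lemma Aut_inverse:
  assumes "g \<in> Aut K"
  shows "restrict (inv_into (universe K) g) (universe K) \<in> Aut K"
proof -
  let ?S = "universe K"
  let ?h = "restrict (inv_into ?S g) ?S"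
  have bij: "bij_betw g ?S ?S" and g: "g \<in> Emb K K"
    using assms by (auto simp: Aut_def Bij_def)
  have h: "?h \<in> Bij ?S"
    using assms by (simp add: Aut_def restrict_inv_into_Bij)
  have "xs \<in> rel K r \<longleftrightarrow> map ?h xs \<in> rel K r" if xs: "set xs \<subseteq> ?S" for r xs
  proof -
    have "set (map ?h xs) \<subseteq> ?S"
      using h xs by (auto simp: Bij_def bij_betw_def)
    moreover have "map g (map ?h xs) = xs"
      using xs bij by (auto simp: bij_betw_def f_inv_into_f intro!: map_idI)
    ultimately show ?thesis
      using g unfolding Emb_def by force
  qed
  moreover have "?h \<in> ?S \<rightarrow>\<^sub>E ?S" "inj_on ?h ?S"
    using h by (auto simp: Bij_def bij_betw_def)
  ultimately show ?thesis
    using h by (simp add: Aut_def Emb_def)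
qed

lemma Aut_compose:
  assumes "g \<in> Aut K" "h \<in> Aut K"
  shows "compose (universe K) g h \<in> Aut K"
  using assms compose_Emb[of h K K g K] compose_Bij[of g "universe K" h] by (simp add: Aut_def)

text \<open>The stabilizer is the trace on \<open>Aut K\<close> of a box with singleton sides over
  \<open>X\<close> and full sides elsewhere. Finiteness of \<open>X\<close> makes the box open in
  the product.\<close>

lemma openin_pointwise_stabilizer:
  assumes "finite X" "X \<subseteq> universe K"
  shows "openin (pointwise_topology K) {g \<in> Aut K. \<forall>x\<in>X. g x = x}"
proof -
  let ?S = "universe K"
  let ?P = "PiE ?S (\<lambda>x. if x \<in> X then {x} else ?S)"
  have "finite {x \<in> ?S. (if x \<in> X then {x} else ?S) \<noteq> topspace (discrete_topology ?S)}"
    by (rule finite_subset[OF _ assms(1)]) auto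
  then have "openin (product_topology (\<lambda>_. discrete_topology ?S) ?S) ?P"
    using assms(2) by (subst openin_PiE_gen) auto
  moreover have "{g \<in> Aut K. \<forall>x\<in>X. g x = x} = ?P \<inter> Aut K"
    using assms(2) by (auto simp: Aut_def Emb_def PiE_iff extensional_def split: if_splits)
  ultimately show ?thesis
    unfolding pointwise_topology_def openin_subtopology by blast
qed

text \<open>Apply precompactness to the pointwise stabilizer of \<open>X\<close>. In a factorization
  k = u h v the right factor v fixes \<open>X\<close>, so on \<open>X\<close> only u h
  remains.\<close>

lemma Roelcke_precompact_stabilizer:
  assumes "Roelcke_precompact (Aut_group K) (pointwise_topology K)"
    and X: "finite X" "X \<subseteq> universe K"
  obtains F where "finite F" "F \<subseteq> Aut K"
    "\<And>k. k \<in> Aut K \<Longrightarrow> \<exists>h\<in>F. \<exists>u\<in>Aut K. (\<forall>x\<in>X. u x = x) \<and> (\<forall>x\<in>X. k x = u (h x))"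
proof -
  let ?S = "universe K"
  let ?U = "{g \<in> Aut K. \<forall>x\<in>X. g x = x}"
  have mult: "g \<otimes>\<^bsub>Aut_group K\<^esub> h = compose ?S g h" if "g \<in> Aut K" "h \<in> Aut K" for g h
    using that by (simp add: Aut_group_def BijGroup_def Aut_def)
  have one: "restrict id ?S \<in> Emb K K"
    by (rule inclusion_Emb) auto
  have "\<one>\<^bsub>Aut_group K\<^esub> \<in> ?U"
    using X(2) one by (auto simp: Aut_group_def BijGroup_def Aut_def id_Bij id_def)
  with openin_pointwise_stabilizer[OF X] obtain F where F: "F \<subseteq> Aut K" "finite F"
    and eq: "?U <#>\<^bsub>Aut_group K\<^esub> F <#>\<^bsub>Aut_group K\<^esub> ?U = Aut K"
    using assms(1) unfolding Roelcke_precompact_def by (auto simp: Aut_group_def)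
  have "\<exists>h\<in>F. \<exists>u\<in>Aut K. (\<forall>x\<in>X. u x = x) \<and> (\<forall>x\<in>X. k x = u (h x))" if "k \<in> Aut K" for k
  proof -
    have "k \<in> ?U <#>\<^bsub>Aut_group K\<^esub> F <#>\<^bsub>Aut_group K\<^esub> ?U"
      using that eq by simp
    then obtain u h v where uhv: "u \<in> ?U" "h \<in> F" "v \<in> ?U"
      and k: "k = u \<otimes>\<^bsub>Aut_group K\<^esub> h \<otimes>\<^bsub>Aut_group K\<^esub> v"
      unfolding set_mult_def by blast
    have "k = compose ?S (compose ?S u h) v"
      using uhv F(1) k by (auto simp: mult Aut_compose)
    then have "\<forall>x\<in>X. k x = u (h x)"
      using uhv(3) X(2) by (auto simp: compose_def)
    then show ?thesis
      using uhv by blast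
  qed
  with F that show ?thesis by blast
qed


section \<open>Exhaustions\<close>

lemma exhaustion_mono:
  assumes "exhaustion K A" "m \<le> n"
  shows "universe (A m) \<subseteq> universe (A n)"
proof (rule lift_Suc_mono_le[OF _ assms(2)])
  show "universe (A k) \<subseteq> universe (A (Suc k))" for k
    using assms(1) by (simp add: exhaustion_def substructure_def)
qed

lemma exhaustion_inclusion:
  assumes "exhaustion K A" "m \<le> n"
  shows "restrict id (universe (A m)) \<in> Emb (A m) (A n)"
proof (rule substructure_inclusion, rule substructure_of_common)
  show "substructure (A m) K" "substructure (A n) K"
    using assms(1) by (simp_all add: exhaustion_def)
qed (rule exhaustion_mono[OF assms])

lemma exhaustion_finite_subset:
  assumes ex: "exhaustion K A" and "finite X" "X \<subseteq> universe K"
  shows "\<exists>n. X \<subseteq> universe (A n)"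
  using assms(2,3)
proof (induction X rule: finite_induct)
  case (insert x X)
  then obtain n where n: "X \<subseteq> universe (A n)" by auto
  have "x \<in> (\<Union>n. universe (A n))"
    using insert.prems ex by (auto simp: exhaustion_def)
  then obtain k where "x \<in> universe (A k)" by blast
  then have "insert x X \<subseteq> universe (A (max n k))"
    using n exhaustion_mono[OF ex, of n "max n k"] exhaustion_mono[OF ex, of k "max n k"] by auto
  then show ?case ..
qed simp

lemma exhaustion_in_age_class:
  assumes "exhaustion K A" "lang_structure ar L K"
  shows "A n \<in> age_class ar L A"
proof -
  have "substructure (A n) K"
    using assms(1) by (simp add: exhaustion_def)
  then have "lang_structure ar L (A n)"
    using assms(2) unfolding lang_structure_def substructure_def by blast
  moreover have "iso_structures (A n) (A n)"
    unfolding iso_structures_def using exhaustion_inclusion[OF assms(1), of n n]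
    by (intro bexI[where x = "restrict id (universe (A n))"]) auto
  ultimately show ?thesis
    by (auto simp: age_class_def)
qed

text \<open>The threshold \<open>i\<close> allows two members of \<open>KS\<close> to be placed
  later over one common \<open>A m\<close>.\<close>

lemma embeds_in_expansion_of_exhaustion:
  assumes ex: "exhaustion K A" and "lang_structure ar L K"
    and expn: "expansion_class ar L L' (age_class ar L A) KS"
    and reas: "reasonable_expansion L (age_class ar L A) KS"
    and B: "B \<in> KS"
  shows "\<exists>i. \<forall>m\<ge>i. \<exists>C\<in>expansions_of L KS (A m). Emb B C \<noteq> {}"
proof -
  have red: "reduct L B \<in> age_class ar L A"
    using expn B by (auto simp: expansion_class_def)
  then obtain i e where e: "e \<in> Emb (reduct L B) (A i)"
    by (auto simp: age_class_def iso_structures_def)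
  have "\<exists>C\<in>expansions_of L KS (A m). Emb B C \<noteq> {}" if im: "i \<le> m" for m
  proof -
    obtain f where f: "f \<in> Emb (reduct L B) (A m)"
      using compose_Emb[OF e exhaustion_inclusion[OF ex im]] by blast
    have "B \<in> expansions_of L KS (reduct L B)"
      using B by (simp add: expansions_of_def)
    \<comment> \<open>Reasonability makes pulling back along \<open>f\<close> surjective onto the
      expansions of \<open>reduct L B\<close>, and \<open>B\<close> is one of these.\<close>
    then obtain C where C: "C \<in> expansions_of L KS (A m)"
      and "B = pullback (universe (reduct L B)) C f"
      using reas red exhaustion_in_age_class[OF assms(1,2)] f
      unfolding reasonable_expansion_def by blast
    then have "f \<in> Emb B C"
      using Emb_pullback_expansion[OF f C] by simp
    with C show ?thesis by blast
  qed
  then show ?thesis by blast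
qed

lemma pairs_of_embeddings_factor:
  assumes K: "Fraisse_structure ar L K" and ex: "exhaustion K A"
    and "Roelcke_precompact (Aut_group K) (pointwise_topology K)"
  shows "\<exists>n\<ge>m. \<forall>f\<in>Emb (A m) K. \<forall>g\<in>Emb (A m) K.
    \<exists>s\<in>Emb (A n) K. \<exists>f'\<in>Emb (A m) (A n). \<exists>g'\<in>Emb (A m) (A n).
      f = compose (universe (A m)) s f' \<and> g = compose (universe (A m)) s g'"
proof -
  let ?S = "universe K" and ?X = "universe (A m)"
  have sub: "\<And>n. substructure (A n) K" and fin: "finite ?X"
    using ex by (auto simp: exhaustion_def)
  then have XS: "?X \<subseteq> ?S"
    by (auto simp: substructure_def)
  obtain F where F: "finite F" "F \<subseteq> Aut K"
    and fac: "\<And>k. k \<in> Aut K \<Longrightarrow>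
      \<exists>h\<in>F. \<exists>u\<in>Aut K. (\<forall>x\<in>?X. u x = x) \<and> (\<forall>x\<in>?X. k x = u (h x))"
    using Roelcke_precompact_stabilizer[OF assms(3) fin XS] by blast
  have FS: "h x \<in> ?S" if "h \<in> F" "x \<in> ?X" for h x
  proof -
    have "h \<in> universe K \<rightarrow> universe K"
      using that F(2) by (auto simp: Aut_def Emb_def)
    then show ?thesis
      using that XS by auto
  qed
  then obtain j where j: "(\<Union>h\<in>F. h ` ?X) \<subseteq> universe (A j)"
    using exhaustion_finite_subset[OF ex, of "\<Union>h\<in>F. h ` ?X"] F(1) fin by auto
  define n where "n = max m j"
  have mn: "m \<le> n" by (simp add: n_def)
  have hn: "h x \<in> universe (A n)" if "h \<in> F" "x \<in> ?X" for h x
    using that j exhaustion_mono[OF ex, of j n] by (auto simp: n_def)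
  have "\<exists>s\<in>Emb (A n) K. \<exists>f'\<in>Emb (A m) (A n). \<exists>g'\<in>Emb (A m) (A n).
      f = compose ?X s f' \<and> g = compose ?X s g'"
    if f: "f \<in> Emb (A m) K" and g: "g \<in> Emb (A m) K" for f g
  proof -
    obtain a b where a: "a \<in> Aut K" "\<forall>x\<in>?X. a x = f x" and b: "b \<in> Aut K" "\<forall>x\<in>?X. b x = g x"
      using K sub fin f g unfolding Fraisse_structure_def by blast
    \<comment> \<open>Moving the pair \<open>(f, g)\<close> by the inverse of \<open>a\<close> turns
      \<open>f\<close> into the inclusion and \<open>g\<close> into the restriction of
      \<open>?k\<close>.\<close>
    let ?k = "compose ?S (restrict (inv_into ?S a) ?S) b"
    have "?k \<in> Aut K"
      by (intro Aut_compose Aut_inverse a b)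
    then obtain h u where h: "h \<in> F" and u: "u \<in> Aut K" "\<forall>x\<in>?X. u x = x"
      and k: "\<forall>x\<in>?X. ?k x = u (h x)"
      using fac by blast
    \<comment> \<open>On \<open>A m\<close> the map \<open>a u\<close> agrees with \<open>f\<close>
      because \<open>u\<close> fixes \<open>A m\<close>, and \<open>a u h\<close> agrees with
      \<open>a ?k = b\<close>, hence with \<open>g\<close>. So \<open>s\<close> is
      \<open>a u\<close> cut down to \<open>A n\<close>.\<close>
    define s where "s = compose (universe (A n)) (compose ?S a u) (restrict id (universe (A n)))"
    let ?f' = "restrict id ?X"
    define g' where "g' = compose ?X h ?f'"
    have s: "s \<in> Emb (A n) K"
      unfolding s_def using Aut_compose[OF a(1) u(1)]
      by (intro compose_Emb[OF substructure_inclusion[OF sub]]) (simp add: Aut_def)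
    have f': "?f' \<in> Emb (A m) (A n)"
      using exhaustion_inclusion[OF ex mn] .
    have hx: "g' x = h x" if "x \<in> ?X" for x
      using that by (simp add: g'_def compose_eq)
    \<comment> \<open>\<open>h\<close> is an automorphism of \<open>K\<close>, so \<open>g'\<close>
      first lands in \<open>K\<close>; the choice of \<open>n\<close> then lets the target shrink to
      \<open>A n\<close>.\<close>
    have "g' \<in> Emb (A m) K"
      unfolding g'_def using h F(2)
      by (intro compose_Emb[OF substructure_inclusion[OF sub]]) (auto simp: Aut_def)
    then have g': "g' \<in> Emb (A m) (A n)"
      by (rule Emb_into_substructure[OF _ sub]) (auto simp: hx hn h)
    have "universe (A n) \<subseteq> ?S"
      using sub[of n] by (simp add: substructure_def)
    then have sx: "s y = a (u y)" if "y \<in> universe (A n)" for y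
      using that by (auto simp: s_def compose_eq)
    have "f = compose ?X s ?f'"
    proof (rule extensionalityI)
      show "f \<in> extensional ?X" using f by (auto simp: Emb_def PiE_def)
      fix x assume x: "x \<in> ?X"
      then have "x \<in> universe (A n)"
        using exhaustion_mono[OF ex mn] by blast
      with x show "f x = compose ?X s ?f' x"
        by (simp add: compose_eq sx a(2) u(2))
    qed (rule compose_extensional)
    moreover have "g = compose ?X s g'"
    proof (rule extensionalityI)
      show "g \<in> extensional ?X" using g by (auto simp: Emb_def PiE_def)
      fix x assume x: "x \<in> ?X"
      then have xS: "x \<in> ?S" using XS by blast
      have "b ` ?S = ?S" "a ` ?S = ?S"
        using a(1) b(1) by (auto simp: Aut_def Bij_def bij_betw_def)
      then have bS: "b x \<in> ?S" and ba: "b x \<in> a ` ?S"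
        using xS by auto
      have "compose ?X s g' x = a (u (h x))"
        using x by (simp add: compose_eq hx sx hn[OF h x])
      also have "\<dots> = a (?k x)"
        using k x by simp
      also have "\<dots> = a (inv_into ?S a (b x))"
        using xS bS by (simp add: compose_eq)
      also have "\<dots> = g x"
        using ba b(2) x by (simp add: f_inv_into_f)
      finally show "g x = compose ?X s g' x" ..
    qed (rule compose_extensional)
    ultimately show ?thesis
      using s f' g' by blast
  qed
  with mn show ?thesis by blast
qed

theorem theorem7p16:
  fixes ar :: "'r \<Rightarrow> nat"
    and L L' :: "'r set"
    and K :: "('a, 'r) rel_struct"
    and A :: "nat \<Rightarrow> ('a, 'r) rel_struct"
    and K' :: "('a, 'r) rel_struct set"
  assumes "Fraisse_structure ar L K"
    and "exhaustion K A"
    and "\<And>n. finite_big_Ramsey_degree K (A n)"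
    and "Roelcke_precompact (Aut_group K) (pointwise_topology K)"
    and "big_Ramsey_expansion ar L L' K A K'"
  shows "joint_embedding_property K'"
  unfolding joint_embedding_property_def
proof (intro ballI)
  fix B C assume BC: "B \<in> K'" "C \<in> K'"
  have lang: "lang_structure ar L K"
    using assms(1) by (simp add: Fraisse_structure_def)
  have exp: "expansion_class ar L L' (age_class ar L A) K'"
    "reasonable_expansion L (age_class ar L A) K'"
    using assms(5) by (auto simp: big_Ramsey_expansion_def)
  obtain i j where
    "\<forall>m\<ge>i. \<exists>B'\<in>expansions_of L K' (A m). Emb B B' \<noteq> {}"
    "\<forall>m\<ge>j. \<exists>C'\<in>expansions_of L K' (A m). Emb C C' \<noteq> {}"
    using embeds_in_expansion_of_exhaustion[OF assms(2) lang exp] BC by metis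
  \<comment> \<open>\<open>m\<close> is the maximum of the two thresholds.\<close>
  then obtain m B' C' p q where
    B': "B' \<in> expansions_of L K' (A m)" "p \<in> Emb B B'" and
    C': "C' \<in> expansions_of L K' (A m)" "q \<in> Emb C C'"
    using max.cobounded1 max.cobounded2 ex_in_conv by metis
  obtain n where mn: "m \<le> n" and factor: "\<forall>f\<in>Emb (A m) K. \<forall>g\<in>Emb (A m) K.
    \<exists>s\<in>Emb (A n) K. \<exists>f'\<in>Emb (A m) (A n). \<exists>g'\<in>Emb (A m) (A n).
      f = compose (universe (A m)) s f' \<and> g = compose (universe (A m)) s g'"
    using pairs_of_embeddings_factor[OF assms(1,2,4)] by blast
  \<comment> \<open>Length \<open>Suc n\<close> is needed for the system to include level
    \<open>n\<close> itself.\<close>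
  obtain \<gamma> :: "nat \<Rightarrow> ('a \<Rightarrow> 'a) \<Rightarrow> nat" and \<sigma> :: "nat \<Rightarrow> nat \<Rightarrow> ('a, 'r) rel_struct" where
    bij: "\<forall>k<Suc n. bij_betw (\<sigma> k) (\<gamma> k ` Emb (A k) K) (expansions_of L K' (A k))" and
    comm: "\<forall>k<Suc n. \<forall>l\<le>k. \<forall>s\<in>Emb (A k) K. \<forall>f\<in>Emb (A l) (A k).
      \<sigma> l (\<gamma> l (compose (universe (A l)) s f)) = pullback (universe (A l)) (\<sigma> k (\<gamma> k s)) f"
    using assms(5)[unfolded big_Ramsey_expansion_def, THEN conjunct2, THEN conjunct2,
        THEN conjunct2, THEN spec, of "Suc n"]
    by (elim exE conjE) (rule that)
  \<comment> \<open>Surjectivity of \<open>\<sigma> m\<close> realizes \<open>B'\<close> and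
    \<open>C'\<close> as expansions attached to the colors of actual embeddings \<open>f\<close> and
    \<open>g\<close>.\<close>
  have "(\<lambda>f. \<sigma> m (\<gamma> m f)) ` Emb (A m) K = expansions_of L K' (A m)"
    using bij mn by (simp add: bij_betw_def image_image)
  then obtain f g where f: "f \<in> Emb (A m) K" "B' = \<sigma> m (\<gamma> m f)"
    and g: "g \<in> Emb (A m) K" "C' = \<sigma> m (\<gamma> m g)"
    using B'(1) C'(1) by blast
  then obtain s f' g' where s: "s \<in> Emb (A n) K"
    and f': "f' \<in> Emb (A m) (A n)" "f = compose (universe (A m)) s f'"
    and g': "g' \<in> Emb (A m) (A n)" "g = compose (universe (A m)) s g'"
    using factor by blast
  let ?D = "\<sigma> n (\<gamma> n s)"
  have D: "?D \<in> expansions_of L K' (A n)"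
    using bij s by (auto simp: bij_betw_def)
  \<comment> \<open>Compatibility of the colorings along \<open>h\<close>: applied to
    \<open>f'\<close> and \<open>g'\<close>, it recovers \<open>B'\<close> and \<open>C'\<close> as
    pullbacks of the single structure \<open>?D\<close>.\<close>
  have "\<sigma> m (\<gamma> m (compose (universe (A m)) s h)) = pullback (universe (A m)) ?D h"
    if "h \<in> Emb (A m) (A n)" for h
    using comm[rule_format, of n m s h] mn s that by simp
  then have "B' = pullback (universe (A m)) ?D f'" "C' = pullback (universe (A m)) ?D g'"
    using f(2) f' g(2) g' by metis+
  then have "f' \<in> Emb B' ?D" "g' \<in> Emb C' ?D"
    using Emb_pullback_expansion[OF _ D] f'(1) g'(1) by auto
  then have "Emb B ?D \<noteq> {}" "Emb C ?D \<noteq> {}"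
    using compose_Emb B'(2) C'(2) by blast+
  moreover have "?D \<in> K'"
    using D by (simp add: expansions_of_def)
  ultimately show "\<exists>D\<in>K'. Emb B D \<noteq> {} \<and> Emb C D \<noteq> {}" by blast
qed

end
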